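(* The following are equivalent for any near prequantale $Q$. (1) $Q$ is simple. (2) The only nuclei on $Q$ are $d$ and $e$. (3) $v(a) = d$ for all $a \in Q$ with $a < \bigvee Q$.
   Context: An ordered magma is a set with a binary operation (written multiplicatively) and a partial order such that $x\le x'$, $y \le y'$ imply $xy \le x'y'$. A near sup-magma is an ordered magma in which every nonempty subset has a supremum. A near prequantale is a near sup-magma $Q$ such that $a(\bigvee X) = \bigvee(aX)$ and $(\bigvee X)a = \bigvee(Xa)$ for every $a \in Q$ and every nonempty $X\subseteq Q$. A map $f$ between near sup-magmas is near sup-preserving if $f(\bigvee X)=\bigvee f(X)$ for every nonempty subset $X$. A near sup-magma $M$ is simple if every nonconstant near sup-preserving magma homomorphism from $M$ to a near sup-magma is injective. A closure operation on a poset is a self-map $\star: x\mapsto x^\star$ that is expansive, order-preserving and idempotent; a nucleus on an ordered magma $M$ is a closure operation $\star$ with $x^\star y^\star \le (xy)^\star$ for all $x,y\in M$. $d$ denotes the identity map of $Q$ and $e$ the map with $x^e = \bigvee Q$ for all $x\in Q$; both are nuclei. Nuclei are ordered pointwise. For $a\in Q$, $v(a)$ denotes the largest nucleus $\star$ on $Q$ such that $a^\star = a$ (which exists for every $a$ in a near prequantale $Q$). *)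

theory Defs
  imports "HOL-Algebra.Lattice"
begin

record 'a ordered_magma = "'a gorder" +
  mult :: "['a, 'a] \<Rightarrow> 'a" (infixl \<open>\<otimes>\<index>\<close> 70)

locale ordered_magma = partial_order Q
  for Q :: "('a, 'm) ordered_magma_scheme" (structure) +
  assumes mult_closed: "\<lbrakk>x \<in> carrier Q; y \<in> carrier Q\<rbrakk> \<Longrightarrow> x \<otimes> y \<in> carrier Q"
    and mult_mono: "\<lbrakk>x \<in> carrier Q; x' \<in> carrier Q; y \<in> carrier Q; y' \<in> carrier Q;
      x \<sqsubseteq> x'; y \<sqsubseteq> y'\<rbrakk> \<Longrightarrow> x \<otimes> y \<sqsubseteq> x' \<otimes> y'"

locale near_sup_magma = ordered_magma +
  assumes nonempty_sup_exists:
    "\<lbrakk>X \<subseteq> carrier Q; X \<noteq> {}\<rbrakk> \<Longrightarrow> \<exists>s. least Q s (Upper Q X)"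

locale near_prequantale = near_sup_magma +
  assumes mult_sup_left: "\<lbrakk>a \<in> carrier Q; X \<subseteq> carrier Q; X \<noteq> {}\<rbrakk> \<Longrightarrow>
      a \<otimes> (\<Squnion>X) = \<Squnion>((\<lambda>x. a \<otimes> x) ` X)"
    and mult_sup_right: "\<lbrakk>a \<in> carrier Q; X \<subseteq> carrier Q; X \<noteq> {}\<rbrakk> \<Longrightarrow>
      (\<Squnion>X) \<otimes> a = \<Squnion>((\<lambda>x. x \<otimes> a) ` X)"

definition magma_hom ::
  "('a, 'm) ordered_magma_scheme \<Rightarrow> ('b, 'n) ordered_magma_scheme \<Rightarrow> ('a \<Rightarrow> 'b) set" where
  "magma_hom M N = {f \<in> carrier M \<rightarrow> carrier N.
     \<forall>x \<in> carrier M. \<forall>y \<in> carrier M. f (x \<otimes>\<^bsub>M\<^esub> y) = f x \<otimes>\<^bsub>N\<^esub> f y}"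

definition near_sup_preserving ::
  "('a, 'm) ordered_magma_scheme \<Rightarrow> ('b, 'n) ordered_magma_scheme \<Rightarrow> ('a \<Rightarrow> 'b) \<Rightarrow> bool" where
  "near_sup_preserving M N f \<longleftrightarrow>
     (\<forall>X. X \<subseteq> carrier M \<and> X \<noteq> {} \<longrightarrow> f (\<Squnion>\<^bsub>M\<^esub> X) = \<Squnion>\<^bsub>N\<^esub> (f ` X))"

text \<open>
  A definition in HOL cannot quantify over all types, so simplicity takes the type containing the
  carriers of the target near sup-magmas as a parameter. Targets range over arbitrary carrier
  subsets of that type, so with the type of \<open>M\<close> itself they include, up to isomorphism,
  every near sup-magma whose carrier is no larger than that of \<open>M\<close>.
\<close>
definition simple :: "'b itself \<Rightarrow> ('a, 'm) ordered_magma_scheme \<Rightarrow> bool" where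
  "simple (T :: 'b itself) M \<longleftrightarrow>
     (\<forall>(N :: 'b ordered_magma) f.
        near_sup_magma N \<and> f \<in> magma_hom M N \<and> near_sup_preserving M N f \<and>
        (\<exists>x \<in> carrier M. \<exists>y \<in> carrier M. f x \<noteq> f y)
        \<longrightarrow> inj_on f (carrier M))"

definition closure_operation :: "('a, 'm) gorder_scheme \<Rightarrow> ('a \<Rightarrow> 'a) \<Rightarrow> bool" where
  "closure_operation L f \<longleftrightarrow>
     f \<in> carrier L \<rightarrow> carrier L \<and>
     (\<forall>x \<in> carrier L. x \<sqsubseteq>\<^bsub>L\<^esub> f x) \<and> isotone L L f \<and> idempotent L f"

text \<open>
  Self-maps of the carrier are represented by extensional functions (undefined off the carrier),
  so that HOL equality of nuclei is equality of maps on the carrier.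
\<close>
definition nuclei :: "('a, 'm) ordered_magma_scheme \<Rightarrow> ('a \<Rightarrow> 'a) set" where
  "nuclei Q = {f \<in> extensional (carrier Q). closure_operation Q f \<and>
     (\<forall>x \<in> carrier Q. \<forall>y \<in> carrier Q. f x \<otimes>\<^bsub>Q\<^esub> f y \<sqsubseteq>\<^bsub>Q\<^esub> f (x \<otimes>\<^bsub>Q\<^esub> y))}"

definition nuclei_order :: "('a, 'm) ordered_magma_scheme \<Rightarrow> ('a \<Rightarrow> 'a) gorder" where
  "nuclei_order Q = \<lparr>carrier = nuclei Q, eq = (=),
     le = (\<lambda>f g. \<forall>x \<in> carrier Q. f x \<sqsubseteq>\<^bsub>Q\<^esub> g x)\<rparr>"

definition d_nucleus :: "('a, 'm) ordered_magma_scheme \<Rightarrow> 'a \<Rightarrow> 'a" where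
  "d_nucleus Q = (\<lambda>x \<in> carrier Q. x)"

definition e_nucleus :: "('a, 'm) ordered_magma_scheme \<Rightarrow> 'a \<Rightarrow> 'a" where
  "e_nucleus Q = (\<lambda>x \<in> carrier Q. \<Squnion>\<^bsub>Q\<^esub> (carrier Q))"

definition v_nucleus :: "('a, 'm) ordered_magma_scheme \<Rightarrow> 'a \<Rightarrow> 'a \<Rightarrow> 'a" where
  "v_nucleus Q a = (THE f. greatest (nuclei_order Q) f {g \<in> nuclei Q. g a = a})"

end

(*
  Nuclei are exactly the kernels of near sup-preserving homomorphisms: a nucleus k is such a
  homomorphism onto its image, the latter with the product k (x y), and a homomorphism f induces
  the nucleus sending x to the largest y with f y \<le> f x. This gives the equivalence of (1) and (2),
  with target carriers that are subsets of Q. For (2) and (3), the elements fixed by every member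
  of a set of nuclei are the fixed points of a nucleus, by residuation. Hence v a exists, and a
  nucleus other than e fixes some a below the top and so lies under v a.
*)
theory Submission
  imports Defs
begin

section \<open>Nuclei on an ordered magma\<close>

context ordered_magma
begin

lemma antisym:
  "\<lbrakk>x \<sqsubseteq> y; y \<sqsubseteq> x; x \<in> carrier Q; y \<in> carrier Q\<rbrakk> \<Longrightarrow> x = y"
  using weak_le_antisym by (simp add: eq_is_equal)

text \<open>\<open>isotone\<close> also asserts that both orders are weak partial orders, and
  \<open>idempotent\<close> is stated with the equality of the structure. Here the former holds and
  the latter is \<open>=\<close>, so plain conditions remain.\<close>

lemma nuclei_iff:
  "f \<in> nuclei Q \<longleftrightarrow> f \<in> extensional (carrier Q) \<and>
     (\<forall>x \<in> carrier Q. f x \<in> carrier Q \<and> x \<sqsubseteq> f x \<and> f (f x) = f x) \<and>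
     (\<forall>x \<in> carrier Q. \<forall>y \<in> carrier Q. x \<sqsubseteq> y \<longrightarrow> f x \<sqsubseteq> f y) \<and>
     (\<forall>x \<in> carrier Q. \<forall>y \<in> carrier Q. f x \<otimes> f y \<sqsubseteq> f (x \<otimes> y))"
  unfolding nuclei_def closure_operation_def isotone_def idempotent_def eq_is_equal
  using weak_partial_order_axioms by auto

lemma nucleus_extensional: "f \<in> nuclei Q \<Longrightarrow> f \<in> extensional (carrier Q)"
  and nucleus_closed: "\<lbrakk>f \<in> nuclei Q; x \<in> carrier Q\<rbrakk> \<Longrightarrow> f x \<in> carrier Q"
  and nucleus_expansive: "\<lbrakk>f \<in> nuclei Q; x \<in> carrier Q\<rbrakk> \<Longrightarrow> x \<sqsubseteq> f x"
  and nucleus_idem: "\<lbrakk>f \<in> nuclei Q; x \<in> carrier Q\<rbrakk> \<Longrightarrow> f (f x) = f x"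
  and nucleus_mono: "\<lbrakk>f \<in> nuclei Q; x \<in> carrier Q; y \<in> carrier Q; x \<sqsubseteq> y\<rbrakk> \<Longrightarrow> f x \<sqsubseteq> f y"
  and nucleus_mult: "\<lbrakk>f \<in> nuclei Q; x \<in> carrier Q; y \<in> carrier Q\<rbrakk> \<Longrightarrow> f x \<otimes> f y \<sqsubseteq> f (x \<otimes> y)"
  by (simp_all add: nuclei_iff)

lemma nucleus_le_fixed:
  "\<lbrakk>f \<in> nuclei Q; f z = z; x \<in> carrier Q; z \<in> carrier Q; x \<sqsubseteq> z\<rbrakk> \<Longrightarrow> f x \<sqsubseteq> z"
  using nucleus_mono[of f x z] by simp

text \<open>Upwards this is expansiveness in both factors; downwards it is the nucleus law, whose
  right-hand side is already fixed by \<open>f\<close>. It makes a nucleus multiplicative onto its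
  image.\<close>

lemma nucleus_mult_eq:
  assumes f: "f \<in> nuclei Q" and x: "x \<in> carrier Q" and y: "y \<in> carrier Q"
  shows "f (f x \<otimes> f y) = f (x \<otimes> y)"
proof (rule antisym)
  note c = nucleus_closed[OF f]
  show "f (f x \<otimes> f y) \<sqsubseteq> f (x \<otimes> y)"
    using nucleus_mult[OF f x y] nucleus_idem[OF f] c x y mult_closed
    by (intro nucleus_le_fixed[OF f]) auto
  show "f (x \<otimes> y) \<sqsubseteq> f (f x \<otimes> f y)"
    using nucleus_expansive[OF f] c x y mult_closed
    by (intro nucleus_mono[OF f] mult_mono) auto
qed (use x y f in \<open>auto intro: nucleus_closed mult_closed\<close>)

lemma d_nucleus_nucleus: "d_nucleus Q \<in> nuclei Q"
  by (auto simp: nuclei_iff d_nucleus_def mult_closed)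

end

section \<open>Suprema of nonempty subsets\<close>

context near_sup_magma
begin

lemma sup_least:
  assumes "X \<subseteq> carrier Q" "X \<noteq> {}"
  shows "least Q (\<Squnion>X) (Upper Q X)"
  unfolding sup_def using nonempty_sup_exists[OF assms] by (rule someI_ex)

lemma sup_closed: "\<lbrakk>X \<subseteq> carrier Q; X \<noteq> {}\<rbrakk> \<Longrightarrow> \<Squnion>X \<in> carrier Q"
  using sup_least least_closed by blast

lemma sup_upper: "\<lbrakk>X \<subseteq> carrier Q; x \<in> X\<rbrakk> \<Longrightarrow> x \<sqsubseteq> \<Squnion>X"
  using sup_least[of X] least_Upper_above[of Q "\<Squnion>X" X x] by blast

lemma sup_le:
  "\<lbrakk>X \<subseteq> carrier Q; X \<noteq> {}; z \<in> carrier Q; \<And>x. x \<in> X \<Longrightarrow> x \<sqsubseteq> z\<rbrakk> \<Longrightarrow> \<Squnion>X \<sqsubseteq> z"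
  using least_le[OF sup_least, of X z] by (auto simp: Upper_def)

lemma sup_eqI:
  assumes "X \<subseteq> carrier Q" "X \<noteq> {}" "s \<in> carrier Q" "\<And>x. x \<in> X \<Longrightarrow> x \<sqsubseteq> s"
    and "\<And>z. \<lbrakk>z \<in> carrier Q; \<And>x. x \<in> X \<Longrightarrow> x \<sqsubseteq> z\<rbrakk> \<Longrightarrow> s \<sqsubseteq> z"
  shows "\<Squnion>X = s"
  using assms by (intro antisym sup_le sup_closed) (auto intro: sup_upper sup_closed)

lemma le_top: "x \<in> carrier Q \<Longrightarrow> x \<sqsubseteq> \<Squnion>carrier Q"
  by (rule sup_upper) auto

lemma e_nucleus_nucleus: "e_nucleus Q \<in> nuclei Q"
proof -
  \<comment> \<open>The carrier may be empty; the element \<open>x\<close> supplies the nonemptiness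
    on which the existence of the top depends.\<close>
  have "x \<in> carrier Q \<Longrightarrow> \<Squnion>carrier Q \<in> carrier Q" for x
    by (rule sup_closed) auto
  then show ?thesis
    by (auto simp: nuclei_iff e_nucleus_def intro!: le_top mult_closed)
qed

section \<open>Kernels of near sup-preserving homomorphisms\<close>

lemma near_sup_preserving_mono:
  assumes N: "near_sup_magma N" and f: "near_sup_preserving Q N f"
    and c: "f \<in> carrier Q \<rightarrow> carrier N"
    and x: "x \<in> carrier Q" and y: "y \<in> carrier Q" and le: "x \<sqsubseteq> y"
  shows "f x \<sqsubseteq>\<^bsub>N\<^esub> f y"
proof -
  \<comment> \<open>Monotonicity is preservation of the supremum of a comparable pair.\<close>
  have "\<Squnion>{x, y} = y"
    using x y le by (intro sup_eqI) auto
  moreover have "f (\<Squnion>{x, y}) = \<Squnion>\<^bsub>N\<^esub> (f ` {x, y})"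
    by (rule f[unfolded near_sup_preserving_def, rule_format]) (use x y in auto)
  moreover have "f x \<sqsubseteq>\<^bsub>N\<^esub> \<Squnion>\<^bsub>N\<^esub> (f ` {x, y})"
    using c x y by (intro near_sup_magma.sup_upper[OF N]) auto
  ultimately show ?thesis by metis
qed

text \<open>The two properties of \<open>k\<close> besides being a nucleus connect it with
  \<open>f\<close>: if \<open>k\<close> is constant then so is \<open>f\<close>, and if
  \<open>k\<close> is the identity then \<open>f\<close> is injective.\<close>

lemma kernel_nucleus:
  assumes N: "near_sup_magma N" and hom: "f \<in> magma_hom Q N" and sp: "near_sup_preserving Q N f"
  obtains k where "k \<in> nuclei Q" "\<And>x. x \<in> carrier Q \<Longrightarrow> f (k x) = f x"
    "\<And>x y. \<lbrakk>x \<in> carrier Q; y \<in> carrier Q; f x = f y\<rbrakk> \<Longrightarrow> k x = k y"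
proof -
  interpret N: near_sup_magma N by (fact N)
  have c: "f \<in> carrier Q \<rightarrow> carrier N"
    and m: "\<And>x y. \<lbrakk>x \<in> carrier Q; y \<in> carrier Q\<rbrakk> \<Longrightarrow> f (x \<otimes> y) = f x \<otimes>\<^bsub>N\<^esub> f y"
    using hom by (auto simp: magma_hom_def)
  note mono = near_sup_preserving_mono[OF N sp c]
  define D where "D x = {y \<in> carrier Q. f y \<sqsubseteq>\<^bsub>N\<^esub> f x}" for x
  define k where "k = (\<lambda>x \<in> carrier Q. \<Squnion>(D x))"
  have D: "D x \<subseteq> carrier Q" "x \<in> D x" if "x \<in> carrier Q" for x
    using that c by (auto simp: D_def)
  have closed: "k x \<in> carrier Q" if "x \<in> carrier Q" for x
    using D[OF that] that unfolding k_def by (auto intro: sup_closed)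
  have upper: "y \<sqsubseteq> k x" if "x \<in> carrier Q" "y \<in> carrier Q" "f y \<sqsubseteq>\<^bsub>N\<^esub> f x" for x y
    using that D[of x] unfolding k_def by (auto intro!: sup_upper simp: D_def)
  have fk: "f (k x) = f x" if x: "x \<in> carrier Q" for x
  proof -
    have "f (\<Squnion>(D x)) = \<Squnion>\<^bsub>N\<^esub> (f ` D x)"
      by (rule sp[unfolded near_sup_preserving_def, rule_format]) (use D[OF x] in auto)
    then have "f (k x) = \<Squnion>\<^bsub>N\<^esub> (f ` D x)"
      using x by (simp add: k_def)
    \<comment> \<open>\<open>f x\<close> is the maximum of the image of \<open>D x\<close>, attained
      at \<open>x\<close>. Hence \<open>k x\<close> lies in \<open>D x\<close> and is its largest
      element.\<close>
    also have "\<dots> = f x"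
    proof (rule N.sup_eqI)
      show "f ` D x \<subseteq> carrier N" using D(1)[OF x] c by auto
      show "f ` D x \<noteq> {}" "f x \<in> carrier N" using D(2)[OF x] x c by auto
      show "y \<sqsubseteq>\<^bsub>N\<^esub> f x" if "y \<in> f ` D x" for y
        using that by (auto simp: D_def)
      show "f x \<sqsubseteq>\<^bsub>N\<^esub> z" if "\<And>y. y \<in> f ` D x \<Longrightarrow> y \<sqsubseteq>\<^bsub>N\<^esub> z" for z
        using D(2)[OF x] by (intro that imageI)
    qed
    finally show ?thesis .
  qed
  have eq: "k x = k y" if "x \<in> carrier Q" "y \<in> carrier Q" "f x = f y" for x y
    using that unfolding k_def D_def by simp
  have "k \<in> nuclei Q"
    unfolding nuclei_iff
  proof (intro conjI ballI impI)
    show "k \<in> extensional (carrier Q)" by (simp add: k_def)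
  next
    fix x assume x: "x \<in> carrier Q"
    show "k x \<in> carrier Q" using x by (rule closed)
    show "x \<sqsubseteq> k x" using x x by (rule upper) (use x c in auto)
    show "k (k x) = k x" using x by (intro eq fk closed)
  next
    fix x y assume x: "x \<in> carrier Q" and y: "y \<in> carrier Q"
    show "k x \<sqsubseteq> k y" if "x \<sqsubseteq> y"
      using x y that by (intro upper closed) (simp_all add: fk mono)
    \<comment> \<open>Since \<open>f\<close> is multiplicative and \<open>f (k x) = f x\<close>, it
      takes the same value at \<open>k x \<otimes> k y\<close> and at
      \<open>x \<otimes> y\<close>.\<close>
    show "k x \<otimes> k y \<sqsubseteq> k (x \<otimes> y)"
      using x y c by (intro upper mult_closed closed) (auto simp: m fk closed intro!: N.mult_closed)
  qed
  from that[OF this fk eq] show ?thesis .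
qed

text \<open>The kernel of a homomorphism is a nucleus on \<open>Q\<close> whatever its target, so
  the target type \<open>'c\<close> can be arbitrary.\<close>

lemma nuclei_trivial_imp_simple:
  assumes "nuclei Q = {d_nucleus Q, e_nucleus Q}"
  shows "simple TYPE('c) Q"
  unfolding simple_def
proof (intro allI impI, elim conjE)
  fix N :: "'c ordered_magma" and f
  assume N: "near_sup_magma N" "f \<in> magma_hom Q N" "near_sup_preserving Q N f"
    and nonconst: "\<exists>x \<in> carrier Q. \<exists>y \<in> carrier Q. f x \<noteq> f y"
  obtain k where k: "k \<in> nuclei Q" and fk: "\<And>x. x \<in> carrier Q \<Longrightarrow> f (k x) = f x"
    and eq: "\<And>x y. \<lbrakk>x \<in> carrier Q; y \<in> carrier Q; f x = f y\<rbrakk> \<Longrightarrow> k x = k y"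
    using kernel_nucleus[OF N] by blast
  \<comment> \<open>Otherwise \<open>f x = f (k x)\<close> would be the value of \<open>f\<close> at
    the top for every \<open>x\<close>.\<close>
  have "k \<noteq> e_nucleus Q"
    using nonconst fk by (metis e_nucleus_def restrict_apply')
  then have "k = d_nucleus Q"
    using k assms by simp
  then show "inj_on f (carrier Q)"
    using eq by (auto simp: inj_on_def d_nucleus_def)
qed

section \<open>The image of a nucleus as a near sup-magma\<close>

text \<open>The set of fixed points of a nucleus need not be closed under the product of
  \<open>Q\<close>, hence the outer \<open>k\<close>. The image stays in the type of
  \<open>Q\<close> and so is an admissible target in \<open>simple TYPE('a)\<close>.\<close>

definition image_magma :: "('a \<Rightarrow> 'a) \<Rightarrow> 'a ordered_magma" where
  "image_magma k = \<lparr>carrier = k ` carrier Q, eq = (=), le = le Q, mult = (\<lambda>x y. k (x \<otimes> y))\<rparr>"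

lemma image_magma_simps [simp]:
  "carrier (image_magma k) = k ` carrier Q"
  "eq (image_magma k) = (=)"
  "le (image_magma k) = le Q"
  "x \<otimes>\<^bsub>image_magma k\<^esub> y = k (x \<otimes> y)"
  by (simp_all add: image_magma_def)

text \<open>The supremum taken in \<open>Q\<close> may leave the image, so it is closed by
  \<open>k\<close>. An upper bound in the image is fixed by \<open>k\<close>, so it stays above the
  closed supremum.\<close>

lemma image_magma_least:
  assumes k: "k \<in> nuclei Q" and X: "X \<subseteq> k ` carrier Q" "X \<noteq> {}"
  shows "least (image_magma k) (k (\<Squnion>X)) (Upper (image_magma k) X)"
proof (rule least_UpperI)
  have XQ: "X \<subseteq> carrier Q"
    using X nucleus_closed[OF k] by auto
  have s: "\<Squnion>X \<in> carrier Q"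
    using XQ X by (intro sup_closed)
  then show "k (\<Squnion>X) \<in> carrier (image_magma k)" by simp
  show "X \<subseteq> carrier (image_magma k)" using X by simp
  show "x \<sqsubseteq>\<^bsub>image_magma k\<^esub> k (\<Squnion>X)" if "x \<in> X" for x
    using that XQ s le_trans[OF sup_upper nucleus_expansive[OF k s]] nucleus_closed[OF k s] by auto
  show "k (\<Squnion>X) \<sqsubseteq>\<^bsub>image_magma k\<^esub> y" if "y \<in> Upper (image_magma k) X" for y
  proof -
    have y: "y \<in> k ` carrier Q" "\<And>x. x \<in> X \<Longrightarrow> x \<sqsubseteq> y"
      using that X by (auto simp: Upper_def)
    then have "y \<in> carrier Q" "k y = y"
      using nucleus_closed[OF k] nucleus_idem[OF k] by auto
    then show ?thesis
      using y XQ X s by (auto intro!: nucleus_le_fixed[OF k] sup_le)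
  qed
qed

lemma image_magma_near_sup_magma:
  assumes k: "k \<in> nuclei Q"
  shows "near_sup_magma (image_magma k)"
proof -
  have c: "\<And>x. x \<in> k ` carrier Q \<Longrightarrow> x \<in> carrier Q"
    using nucleus_closed[OF k] by auto
  show ?thesis
  proof
    fix x y assume "x \<in> carrier (image_magma k)" "y \<in> carrier (image_magma k)"
    then show "x \<otimes>\<^bsub>image_magma k\<^esub> y \<in> carrier (image_magma k)"
      using c by (simp add: mult_closed)
  next
    fix x x' y y'
    assume "x \<in> carrier (image_magma k)" "x' \<in> carrier (image_magma k)"
      "y \<in> carrier (image_magma k)" "y' \<in> carrier (image_magma k)"
      "x \<sqsubseteq>\<^bsub>image_magma k\<^esub> x'" "y \<sqsubseteq>\<^bsub>image_magma k\<^esub> y'"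
    then show "x \<otimes>\<^bsub>image_magma k\<^esub> y \<sqsubseteq>\<^bsub>image_magma k\<^esub> x' \<otimes>\<^bsub>image_magma k\<^esub> y'"
      using c by (simp add: nucleus_mono[OF k] mult_closed mult_mono)
  next
    fix X assume "X \<subseteq> carrier (image_magma k)" "X \<noteq> {}"
    then show "\<exists>s. least (image_magma k) s (Upper (image_magma k) X)"
      using image_magma_least[OF k] by auto
  qed (use c in \<open>auto intro: antisym le_trans\<close>)
qed

lemma nucleus_magma_hom:
  assumes k: "k \<in> nuclei Q"
  shows "k \<in> magma_hom Q (image_magma k)"
  by (auto simp: magma_hom_def nucleus_mult_eq[OF k])

lemma nucleus_near_sup_preserving:
  assumes k: "k \<in> nuclei Q"
  shows "near_sup_preserving Q (image_magma k) k"
  unfolding near_sup_preserving_def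
proof (intro allI impI, elim conjE)
  fix X assume X: "X \<subseteq> carrier Q" "X \<noteq> {}"
  interpret N: near_sup_magma "image_magma k" using k by (rule image_magma_near_sup_magma)
  note c = nucleus_closed[OF k]
  have s: "\<Squnion>X \<in> carrier Q" using X by (rule sup_closed)
  have "\<Squnion>\<^bsub>image_magma k\<^esub> (k ` X) = k (\<Squnion>X)"
  proof (rule N.sup_eqI)
    show "x \<sqsubseteq>\<^bsub>image_magma k\<^esub> k (\<Squnion>X)" if "x \<in> k ` X" for x
      using that X s by (auto intro!: nucleus_mono[OF k] sup_upper)
    show "k (\<Squnion>X) \<sqsubseteq>\<^bsub>image_magma k\<^esub> z"
      if z: "z \<in> carrier (image_magma k)" "\<And>x. x \<in> k ` X \<Longrightarrow> x \<sqsubseteq>\<^bsub>image_magma k\<^esub> z" for z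
    proof -
      have zQ: "z \<in> carrier Q" "k z = z"
        using z(1) c nucleus_idem[OF k] by auto
      \<comment> \<open>By expansiveness, \<open>z\<close> bounds \<open>X\<close> itself and so its
        supremum in \<open>Q\<close>; being fixed, it then bounds
        \<open>k (\<Squnion>X)\<close>.\<close>
      have "x \<sqsubseteq> z" if "x \<in> X" for x
      proof (rule le_trans)
        show "x \<sqsubseteq> k x" using that X by (auto intro: nucleus_expansive[OF k])
        show "k x \<sqsubseteq> z" using z(2)[of "k x"] that by simp
      qed (use that X c zQ in auto)
      then show ?thesis
        using zQ X s by (auto intro!: nucleus_le_fixed[OF k] sup_le)
    qed
  qed (use X s in auto)
  then show "k (\<Squnion>X) = \<Squnion>\<^bsub>image_magma k\<^esub> (k ` X)" by simp
qed

text \<open>Simplicity is applied to \<open>k\<close> as a homomorphism onto its own image: an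
  injective \<open>k\<close> is \<open>d\<close>, a constant one is \<open>e\<close>.\<close>

lemma simple_imp_nuclei_trivial:
  assumes "simple TYPE('a) Q"
  shows "nuclei Q = {d_nucleus Q, e_nucleus Q}"
proof
  show "nuclei Q \<subseteq> {d_nucleus Q, e_nucleus Q}"
  proof
    fix k assume k: "k \<in> nuclei Q"
    note c = nucleus_closed[OF k]
    show "k \<in> {d_nucleus Q, e_nucleus Q}"
    proof (cases "\<exists>x \<in> carrier Q. \<exists>y \<in> carrier Q. k x \<noteq> k y")
      case True
      then have "inj_on k (carrier Q)"
        using assms image_magma_near_sup_magma[OF k] nucleus_magma_hom[OF k]
          nucleus_near_sup_preserving[OF k]
        unfolding simple_def by blast
      \<comment> \<open>Injectivity cancels the outer \<open>k\<close> in
        \<open>k (k x) = k x\<close>.\<close>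
      then have "\<And>x. x \<in> carrier Q \<Longrightarrow> k x = x"
        using c nucleus_idem[OF k] by (meson inj_onD)
      then have "k = d_nucleus Q"
        by (intro extensionalityI[OF nucleus_extensional[OF k]]) (auto simp: d_nucleus_def)
      then show ?thesis by simp
    next
      case False
      \<comment> \<open>The constant value is the value at the top, which expansiveness forces to be
        the top.\<close>
      have "k x = \<Squnion>carrier Q" if x: "x \<in> carrier Q" for x
      proof (rule antisym)
        have t: "\<Squnion>carrier Q \<in> carrier Q" using x by (intro sup_closed) auto
        then have "k x = k (\<Squnion>carrier Q)" using False x by blast
        then show "\<Squnion>carrier Q \<sqsubseteq> k x" using nucleus_expansive[OF k t] by simp
        show "\<Squnion>carrier Q \<in> carrier Q" by (fact t)
      qed (use x c in \<open>auto intro: le_top\<close>)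
      then have "k = e_nucleus Q"
        by (intro extensionalityI[OF nucleus_extensional[OF k]]) (auto simp: e_nucleus_def)
      then show ?thesis by simp
    qed
  qed
qed (simp add: d_nucleus_nucleus e_nucleus_nucleus)

end

section \<open>Residuals and joins of nuclei\<close>

context near_prequantale
begin

text \<open>The witness is the residual of \<open>z\<close> by \<open>y\<close>, the largest
  \<open>w\<close> with \<open>w \<otimes> y \<sqsubseteq> z\<close>. Any nucleus fixing
  \<open>z\<close> fixes it too, which allows a factor to be closed without leaving the elements
  below \<open>z\<close>.\<close>

lemma left_residual_fixed:
  assumes S: "S \<subseteq> nuclei Q" and x: "x \<in> carrier Q" and y: "y \<in> carrier Q"
    and z: "z \<in> carrier Q" "\<forall>g \<in> S. g z = z" and le: "x \<otimes> y \<sqsubseteq> z"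
  obtains r where "r \<in> carrier Q" "\<forall>g \<in> S. g r = r" "x \<sqsubseteq> r" "r \<otimes> y \<sqsubseteq> z"
proof
  define W where "W = {w \<in> carrier Q. w \<otimes> y \<sqsubseteq> z}"
  have W: "W \<subseteq> carrier Q" "W \<noteq> {}" "x \<in> W"
    using x le by (auto simp: W_def)
  show r: "\<Squnion>W \<in> carrier Q" using W by (intro sup_closed)
  show "x \<sqsubseteq> \<Squnion>W" using W by (intro sup_upper)
  \<comment> \<open>Distributivity puts the supremum of \<open>W\<close> into
    \<open>W\<close>.\<close>
  show ry: "\<Squnion>W \<otimes> y \<sqsubseteq> z"
    unfolding mult_sup_right[OF y W(1,2)]
    using W y z by (intro sup_le) (auto simp: W_def mult_closed)
  show "\<forall>g \<in> S. g (\<Squnion>W) = \<Squnion>W"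
  proof (intro ballI antisym)
    fix g assume that: "g \<in> S"
    have g: "g \<in> nuclei Q" using that S by auto
    note c = nucleus_closed[OF g]
    \<comment> \<open>The chain shows that \<open>g (\<Squnion>W)\<close> again belongs to
      \<open>W\<close>, so it lies below the supremum.\<close>
    have "g (\<Squnion>W) \<otimes> y \<sqsubseteq> g (\<Squnion>W) \<otimes> g y"
      using r y c by (intro mult_mono) (auto intro: nucleus_expansive[OF g])
    also have "\<dots> \<sqsubseteq> g (\<Squnion>W \<otimes> y)"
      using r y by (rule nucleus_mult[OF g])
    also have "\<dots> \<sqsubseteq> z"
      using ry r y z that by (intro nucleus_le_fixed[OF g] mult_closed) auto
    finally have "g (\<Squnion>W) \<otimes> y \<sqsubseteq> z"
      using r y z c by (simp add: mult_closed)
    then show "g (\<Squnion>W) \<sqsubseteq> \<Squnion>W"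
      using c r W by (intro sup_upper) (auto simp: W_def)
    show "\<Squnion>W \<sqsubseteq> g (\<Squnion>W)" using r by (rule nucleus_expansive[OF g])
    show "g (\<Squnion>W) \<in> carrier Q" "\<Squnion>W \<in> carrier Q" using r c by auto
  qed
qed

text \<open>The mirror image: the residual of \<open>z\<close> by \<open>x\<close> on the other
  side, obtained from distributivity of left multiplication.\<close>

lemma right_residual_fixed:
  assumes S: "S \<subseteq> nuclei Q" and x: "x \<in> carrier Q" and y: "y \<in> carrier Q"
    and z: "z \<in> carrier Q" "\<forall>g \<in> S. g z = z" and le: "x \<otimes> y \<sqsubseteq> z"
  obtains r where "r \<in> carrier Q" "\<forall>g \<in> S. g r = r" "y \<sqsubseteq> r" "x \<otimes> r \<sqsubseteq> z"
proof
  define W where "W = {w \<in> carrier Q. x \<otimes> w \<sqsubseteq> z}"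
  have W: "W \<subseteq> carrier Q" "W \<noteq> {}" "y \<in> W"
    using y le by (auto simp: W_def)
  show r: "\<Squnion>W \<in> carrier Q" using W by (intro sup_closed)
  show "y \<sqsubseteq> \<Squnion>W" using W by (intro sup_upper)
  show xr: "x \<otimes> \<Squnion>W \<sqsubseteq> z"
    unfolding mult_sup_left[OF x W(1,2)]
    using W x z by (intro sup_le) (auto simp: W_def mult_closed)
  show "\<forall>g \<in> S. g (\<Squnion>W) = \<Squnion>W"
  proof (intro ballI antisym)
    fix g assume that: "g \<in> S"
    have g: "g \<in> nuclei Q" using that S by auto
    note c = nucleus_closed[OF g]
    have "x \<otimes> g (\<Squnion>W) \<sqsubseteq> g x \<otimes> g (\<Squnion>W)"
      using r x c by (intro mult_mono) (auto intro: nucleus_expansive[OF g])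
    also have "\<dots> \<sqsubseteq> g (x \<otimes> \<Squnion>W)"
      using x r by (rule nucleus_mult[OF g])
    also have "\<dots> \<sqsubseteq> z"
      using xr r x z that by (intro nucleus_le_fixed[OF g] mult_closed) auto
    finally have "x \<otimes> g (\<Squnion>W) \<sqsubseteq> z"
      using r x z c by (simp add: mult_closed)
    then show "g (\<Squnion>W) \<sqsubseteq> \<Squnion>W"
      using c r W by (intro sup_upper) (auto simp: W_def)
    show "\<Squnion>W \<sqsubseteq> g (\<Squnion>W)" using r by (rule nucleus_expansive[OF g])
    show "g (\<Squnion>W) \<in> carrier Q" "\<Squnion>W \<in> carrier Q" using r c by auto
  qed
qed

text \<open>The join of \<open>S\<close> sends \<open>x\<close> to the least element above
  \<open>x\<close> among the common fixed points \<open>F\<close>. The residuals of members of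
  \<open>F\<close> stay in \<open>F\<close>, and this yields the nucleus law.\<close>

lemma nuclei_join:
  assumes S: "S \<subseteq> nuclei Q"
  obtains m where "m \<in> nuclei Q"
    "\<And>g x. \<lbrakk>g \<in> S; x \<in> carrier Q\<rbrakk> \<Longrightarrow> g x \<sqsubseteq> m x"
    "\<And>a. \<lbrakk>a \<in> carrier Q; \<And>g. g \<in> S \<Longrightarrow> g a = a\<rbrakk> \<Longrightarrow> m a = a"
proof -
  define F where "F = {z \<in> carrier Q. \<forall>g \<in> S. g z = z}"
  \<comment> \<open>Infima are not given directly, so the infimum of the members of \<open>F\<close>
    above \<open>x\<close> is formed as the supremum of their lower bounds \<open>L x\<close>;
    \<open>x\<close> itself keeps \<open>L x\<close> nonempty.\<close>
  define L where "L x = {l \<in> carrier Q. \<forall>z \<in> F. x \<sqsubseteq> z \<longrightarrow> l \<sqsubseteq> z}" for x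
  define m where "m = (\<lambda>x \<in> carrier Q. \<Squnion>(L x))"
  have FQ: "z \<in> carrier Q" if "z \<in> F" for z
    using that by (simp add: F_def)
  have L: "L x \<subseteq> carrier Q" "x \<in> L x" if "x \<in> carrier Q" for x
    using that by (auto simp: L_def)
  have closed: "m x \<in> carrier Q" if "x \<in> carrier Q" for x
    using L[OF that] that unfolding m_def by (auto intro: sup_closed)
  have upper: "l \<sqsubseteq> m x" if "x \<in> carrier Q" "l \<in> L x" for x l
    using that L[of x] by (auto simp: m_def intro: sup_upper)
  have below: "m x \<sqsubseteq> z" if "x \<in> carrier Q" "z \<in> F" "x \<sqsubseteq> z" for x z
    using that L[of x] unfolding m_def by (auto intro!: sup_le simp: FQ L_def)
  have expansive: "x \<sqsubseteq> m x" if "x \<in> carrier Q" for x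
    using that L by (intro upper)
  have mF: "m x \<in> F" if x: "x \<in> carrier Q" for x
  proof -
    have "g (m x) = m x" if "g \<in> S" for g
    proof (rule antisym)
      have g: "g \<in> nuclei Q" using that S by auto
      show gc: "g (m x) \<in> carrier Q" using nucleus_closed[OF g] closed x by simp
      \<comment> \<open>Each such \<open>z\<close> is fixed by \<open>g\<close>, so
        \<open>g (m x)\<close> is still a lower bound and belongs to \<open>L x\<close>.\<close>
      have "g (m x) \<sqsubseteq> z" if "z \<in> F" "x \<sqsubseteq> z" for z
        using that \<open>g \<in> S\<close> x below closed by (intro nucleus_le_fixed[OF g]) (auto simp: F_def)
      then show "g (m x) \<sqsubseteq> m x"
        using gc x by (intro upper) (auto simp: L_def)
      show "m x \<sqsubseteq> g (m x)" using closed x by (intro nucleus_expansive[OF g])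
    qed (rule closed[OF x])
    then show ?thesis using closed x by (simp add: F_def)
  qed
  have fixed: "m z = z" if "z \<in> F" for z
    using that FQ expansive below closed by (intro antisym) auto
  have left: "m x \<otimes> y \<sqsubseteq> z"
    if x: "x \<in> carrier Q" and y: "y \<in> carrier Q" and z: "z \<in> F" and le: "x \<otimes> y \<sqsubseteq> z" for x y z
  proof -
    have zS: "\<forall>g \<in> S. g z = z" using z by (simp add: F_def)
    obtain r where r: "r \<in> carrier Q" "\<forall>g \<in> S. g r = r" "x \<sqsubseteq> r" "r \<otimes> y \<sqsubseteq> z"
      using left_residual_fixed[OF S x y FQ[OF z] zS le] by blast
    \<comment> \<open>The residual \<open>r\<close> is a member of \<open>F\<close> above
      \<open>x\<close>, so it bounds the closure of \<open>x\<close> as well.\<close>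
    have "m x \<sqsubseteq> r" using r x by (intro below) (auto simp: F_def)
    then have "m x \<otimes> y \<sqsubseteq> r \<otimes> y" using x y r closed by (intro mult_mono) auto
    then show ?thesis using r x y FQ[OF z] closed by (meson le_trans mult_closed)
  qed
  have right: "x \<otimes> m y \<sqsubseteq> z"
    if x: "x \<in> carrier Q" and y: "y \<in> carrier Q" and z: "z \<in> F" and le: "x \<otimes> y \<sqsubseteq> z" for x y z
  proof -
    have zS: "\<forall>g \<in> S. g z = z" using z by (simp add: F_def)
    obtain r where r: "r \<in> carrier Q" "\<forall>g \<in> S. g r = r" "y \<sqsubseteq> r" "x \<otimes> r \<sqsubseteq> z"
      using right_residual_fixed[OF S x y FQ[OF z] zS le] by blast
    have "m y \<sqsubseteq> r" using r y by (intro below) (auto simp: F_def)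
    then have "x \<otimes> m y \<sqsubseteq> x \<otimes> r" using x y r closed by (intro mult_mono) auto
    then show ?thesis using r x y FQ[OF z] closed by (meson le_trans mult_closed)
  qed
  show ?thesis
  proof
    show "m \<in> nuclei Q"
      unfolding nuclei_iff
    proof (intro conjI ballI impI)
      show "m \<in> extensional (carrier Q)" by (simp add: m_def)
    next
      fix x assume x: "x \<in> carrier Q"
      show "m x \<in> carrier Q" "x \<sqsubseteq> m x" "m (m x) = m x"
        using x closed expansive fixed mF by auto
    next
      fix x y assume x: "x \<in> carrier Q" and y: "y \<in> carrier Q"
      show "m x \<sqsubseteq> m y" if "x \<sqsubseteq> y"
        using le_trans[OF that expansive[OF y]] x y closed mF by (intro below) auto
      \<comment> \<open>The factors of \<open>x \<otimes> y \<sqsubseteq> m (x \<otimes> y)\<close>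
        are closed one at a time, with the right-hand side as the member \<open>z\<close> of
        \<open>F\<close>.\<close>
      show "m x \<otimes> m y \<sqsubseteq> m (x \<otimes> y)"
        using x y mF closed mult_closed by (intro left right expansive) auto
    qed
    show "g x \<sqsubseteq> m x" if "g \<in> S" "x \<in> carrier Q" for g x
    proof (rule nucleus_le_fixed[where f = g and x = x])
      show "g \<in> nuclei Q" using that S by blast
      show "g (m x) = m x" using mF[OF that(2)] that(1) by (simp add: F_def)
    qed (use that closed expansive in simp_all)
    show "m a = a" if "a \<in> carrier Q" "\<And>g. g \<in> S \<Longrightarrow> g a = a" for a
      using that by (intro fixed) (simp add: F_def)
  qed
qed

section \<open>The nuclei \<open>v a\<close> and the triviality of all nuclei\<close>

text \<open>The join of all nuclei fixing \<open>a\<close> again fixes \<open>a\<close>, so it is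
  the greatest of them.\<close>

lemma v_nucleus_greatest:
  assumes a: "a \<in> carrier Q"
  shows "greatest (nuclei_order Q) (v_nucleus Q a) {g \<in> nuclei Q. g a = a}"
  unfolding v_nucleus_def
proof (rule theI'[where P = "\<lambda>f. greatest (nuclei_order Q) f {g \<in> nuclei Q. g a = a}"])
  obtain m where m: "m \<in> nuclei Q"
    "\<And>g x. \<lbrakk>g \<in> {g \<in> nuclei Q. g a = a}; x \<in> carrier Q\<rbrakk> \<Longrightarrow> g x \<sqsubseteq> m x"
    "\<And>b. \<lbrakk>b \<in> carrier Q; \<And>g. g \<in> {g \<in> nuclei Q. g a = a} \<Longrightarrow> g b = b\<rbrakk> \<Longrightarrow> m b = b"
    using nuclei_join[of "{g \<in> nuclei Q. g a = a}"] by blast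
  show "\<exists>!f. greatest (nuclei_order Q) f {g \<in> nuclei Q. g a = a}"
  proof
    show "greatest (nuclei_order Q) m {g \<in> nuclei Q. g a = a}"
      using m a by (auto simp: greatest_def nuclei_order_def)
    fix f assume f: "greatest (nuclei_order Q) f {g \<in> nuclei Q. g a = a}"
    have fn: "f \<in> nuclei Q" "f a = a" using f by (auto simp: greatest_def)
    have "m a = a" using m a by auto
    then have "\<And>x. x \<in> carrier Q \<Longrightarrow> m x \<sqsubseteq> f x"
      using f m(1) by (auto simp: greatest_def nuclei_order_def)
    \<comment> \<open>Antisymmetry gives equality on the carrier only; extensionality makes it the
      equality of functions that \<open>THE\<close> demands.\<close>
    then show "f = m"
      using m fn by (intro extensionalityI[OF nucleus_extensional nucleus_extensional] antisym)
        (auto intro: nucleus_closed)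
  qed
qed

lemma nuclei_trivial_iff_v_nucleus:
  "nuclei Q = {d_nucleus Q, e_nucleus Q} \<longleftrightarrow>
    (\<forall>a \<in> carrier Q. a \<sqsubset> \<Squnion>(carrier Q) \<longrightarrow> v_nucleus Q a = d_nucleus Q)"
proof
  assume triv: "nuclei Q = {d_nucleus Q, e_nucleus Q}"
  show "\<forall>a \<in> carrier Q. a \<sqsubset> \<Squnion>(carrier Q) \<longrightarrow> v_nucleus Q a = d_nucleus Q"
  proof (intro ballI impI)
    fix a assume a: "a \<in> carrier Q" "a \<sqsubset> \<Squnion>(carrier Q)"
    have "v_nucleus Q a \<in> nuclei Q" "v_nucleus Q a a = a"
      using v_nucleus_greatest[OF a(1)] by (auto simp: greatest_def)
    \<comment> \<open>\<open>e\<close> moves \<open>a\<close> to the top, whereas \<open>v a\<close>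
      fixes \<open>a\<close>; only \<open>d\<close> remains.\<close>
    then show "v_nucleus Q a = d_nucleus Q"
      using triv a by (auto simp: lless_eq e_nucleus_def)
  qed
next
  assume v: "\<forall>a \<in> carrier Q. a \<sqsubset> \<Squnion>(carrier Q) \<longrightarrow> v_nucleus Q a = d_nucleus Q"
  have "k = d_nucleus Q" if k: "k \<in> nuclei Q" and ne: "k \<noteq> e_nucleus Q" for k
  proof -
    note c = nucleus_closed[OF k]
    have "\<exists>x \<in> carrier Q. k x \<noteq> \<Squnion>(carrier Q)"
    proof (rule ccontr)
      assume "\<not> ?thesis"
      then have "k = e_nucleus Q"
        by (intro extensionalityI[OF nucleus_extensional[OF k]]) (auto simp: e_nucleus_def)
      then show False using ne by contradiction
    qed
    then obtain x where x: "x \<in> carrier Q" "k x \<noteq> \<Squnion>(carrier Q)" by blast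
    \<comment> \<open>The element below the top is the value \<open>k x\<close>, which
      \<open>k\<close> fixes by idempotence.\<close>
    then have "v_nucleus Q (k x) = d_nucleus Q"
      using v c le_top by (simp add: lless_eq)
    then have "\<And>y. y \<in> carrier Q \<Longrightarrow> k y \<sqsubseteq> y"
      using v_nucleus_greatest[OF c[OF x(1)]] k nucleus_idem[OF k x(1)]
      by (auto simp: greatest_def nuclei_order_def d_nucleus_def)
    then show ?thesis
      by (intro extensionalityI[OF nucleus_extensional[OF k]])
        (auto simp: d_nucleus_def intro!: antisym c nucleus_expansive[OF k])
  qed
  then show "nuclei Q = {d_nucleus Q, e_nucleus Q}"
    using d_nucleus_nucleus e_nucleus_nucleus by blast
qed

end

text \<open>The last conjunct removes the dependence on the target type: simplicity tested on
  targets in the type of \<open>Q\<close> makes the nuclei trivial, and this gives simplicity for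
  every type \<open>'b\<close>.\<close>

theorem corollary5p3:
  fixes Q :: "'a ordered_magma"
  assumes "near_prequantale Q"
  shows "(simple TYPE('a) Q \<longleftrightarrow> nuclei Q = {d_nucleus Q, e_nucleus Q}) \<and>
    (nuclei Q = {d_nucleus Q, e_nucleus Q} \<longleftrightarrow>
      (\<forall>a \<in> carrier Q. a \<sqsubset>\<^bsub>Q\<^esub> \<Squnion>\<^bsub>Q\<^esub> (carrier Q) \<longrightarrow> v_nucleus Q a = d_nucleus Q)) \<and>
    (simple TYPE('a) Q \<longrightarrow> simple TYPE('b) Q)"
proof -
  interpret near_prequantale Q by (fact assms)
  show ?thesis
    using simple_imp_nuclei_trivial nuclei_trivial_imp_simple[where 'c = 'a]
      nuclei_trivial_imp_simple[where 'c = 'b] nuclei_trivial_iff_v_nucleus by blast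
qed

end
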